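(* Let $0<\varepsilon<1/100$. The set $\mathcal{A}_\varepsilon\subset\mathbb{R}^2$ is closed.
   Context: Triangular caps: for a segment $S=[a,b]\subset\mathbb{R}^2$ and $h>0$, an $h$-triangular cap on $S$ is the closed solid isosceles triangle with base $S$ and third vertex (apex) $\frac{a+b}{2}+c$, where $|c|=h$ and $c\perp b-a$. If $S$ is an edge of a previously constructed cap $T$, the side is chosen so that the new cap is contained in $T$; on the initial segment $[(0,0),(1,0)]$ the apex has positive second coordinate. Construction of $A_\varepsilon$: Let $A_0=A_{0,1}=[(0,0),(1,0)]$. Given $A_n=\bigcup_{i=1}^{2^n}A_{n,i}$, a polygonal curve from $(0,0)$ to $(1,0)$ whose segments are numbered consecutively from $(0,0)$ to $(1,0)$, let $T_{n,i}$ be the $2^{1-n}\varepsilon$-triangular cap on $A_{n,i}$, let $A_{n+1,2i-1},A_{n+1,2i}$ be the two edges of $T_{n,i}$ other than its base $A_{n,i}$, and let $A_{n+1}=\bigcup_{k=1}^{2^{n+1}}A_{n+1,k}$. Define $A_\varepsilon:=\overline{\bigcup_{n=1}^\infty A_n}\setminus\bigcup_{n=1}^\infty A_n$. Construction of $\mathcal{A}_\varepsilon$: Let $a_{n,i}$ be the apex of $T_{n,i}$. Set $e_1=(0,0)$, $e_2=(1,0)$ and $e_{2+i+\sum_{j=0}^{n-1}2^j}=a_{n,i}$ for $n\ge0$, $1\le i\le 2^n$. Set $\rho_1=\frac14 2^{-7}(1+7\cdot16\varepsilon^2)^{1/2}$ and $\rho_i=4^{1-i}\rho_1$. Let $r_1=\rho_1$,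 $r_2=\rho_2$, and for $i\ge3$, with $n\ge0$ the unique integer such that $2+\sum_{j=0}^n2^j\le i\le 1+\sum_{j=0}^{n+1}2^j$, let $r_i=\min\{\rho_i,\tfrac12 d(e_i,A_{n-1}\cup A_{n-2})\}$, where sets $A_k$ with $k<0$ are omitted (so $r_i=\rho_i$ when $n=0$). Define $\mathcal{A}_\varepsilon:=A_\varepsilon\setminus\bigcup_{i=1}^\infty B_{r_i}(e_i)$, with $B_r(e)$ open balls. *)

theory Defs
  imports "HOL-Analysis.Analysis"
begin

type_synonym point = "real^2"

definition is_cap_apex :: "real \<Rightarrow> point \<Rightarrow> point \<Rightarrow> point \<Rightarrow> bool" where
  "is_cap_apex h a b p \<longleftrightarrow>
     (\<exists>c. norm c = h \<and> orthogonal c (b - a) \<and> p = midpoint a b + c)"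

definition triangle :: "point \<Rightarrow> point \<Rightarrow> point \<Rightarrow> point set" where
  "triangle a b p = convex hull {a, b, p}"

definition cap_height :: "real \<Rightarrow> nat \<Rightarrow> real" where
  "cap_height \<epsilon> n = 2 powi (1 - int n) * \<epsilon>"

text \<open>
  \<open>cap_data \<epsilon> n i = (a, b, p)\<close>, meaningful for \<open>1 \<le> i \<le> 2 ^ n\<close>: the base \<open>A\<^sub>n\<^sub>,\<^sub>i\<close> is the segment
  from \<open>a\<close> to \<open>b\<close>, in the direction in which the curve \<open>A\<^sub>n\<close> is traversed from (0,0) to (1,0),
  and \<open>p\<close> is the apex of \<open>T\<^sub>n\<^sub>,\<^sub>i\<close>. The parent of \<open>T\<^sub>n\<^sub>+\<^sub>1\<^sub>,\<^sub>i\<close> is \<open>T\<^sub>n\<^sub>,\<^sub>k\<close> with \<open>i = 2 * k - 1\<close> or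
  \<open>i = 2 * k\<close>, that is, \<open>k = (i + 1) div 2\<close>.

  Each \<open>SOME\<close> picks one of the two possible apices of an isosceles triangle with given base and
  height. For \<open>\<epsilon> > 0\<close> exactly one of them meets the condition on the side: the base angles of
  the caps have tangent \<open>4 * \<epsilon> / sqrt (1 + 16 * n * \<epsilon>\<^sup>2)\<close>, which decreases with \<open>n\<close>, so the cap
  erected towards the inside of the parent fits into it, and the other one does not.
\<close>

primrec cap_data :: "real \<Rightarrow> nat \<Rightarrow> nat \<Rightarrow> point \<times> point \<times> point" where
  "cap_data \<epsilon> 0 i =
     (let a = vector [0, 0]; b = vector [1, 0]
      in (a, b, SOME p. is_cap_apex (cap_height \<epsilon> 0) a b p \<and> p $ 2 > 0))"
| "cap_data \<epsilon> (Suc n) i =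
     (let (a, b, p) = cap_data \<epsilon> n ((i + 1) div 2);
          (c, d) = (if odd i then (a, p) else (p, b))
      in (c, d, SOME q. is_cap_apex (cap_height \<epsilon> (Suc n)) c d q \<and>
                        triangle c d q \<subseteq> triangle a b p))"

definition apex :: "real \<Rightarrow> nat \<Rightarrow> nat \<Rightarrow> point" where
  "apex \<epsilon> n i = snd (snd (cap_data \<epsilon> n i))"

definition A_seg :: "real \<Rightarrow> nat \<Rightarrow> nat \<Rightarrow> point set" where
  "A_seg \<epsilon> n i = closed_segment (fst (cap_data \<epsilon> n i)) (fst (snd (cap_data \<epsilon> n i)))"

definition A_curve :: "real \<Rightarrow> nat \<Rightarrow> point set" where
  "A_curve \<epsilon> n = (\<Union>i\<in>{1..2 ^ n}. A_seg \<epsilon> n i)"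

definition A_eps :: "real \<Rightarrow> point set" where
  "A_eps \<epsilon> = closure (\<Union>n\<in>{1..}. A_curve \<epsilon> n) - (\<Union>n\<in>{1..}. A_curve \<epsilon> n)"

text \<open>The enumerations below start at index 1; their values at 0 are never used.\<close>

definition e_pt :: "real \<Rightarrow> nat \<Rightarrow> point" where
  "e_pt \<epsilon> i =
     (if i = 1 then vector [0, 0]
      else if i = 2 then vector [1, 0]
      else (THE p. \<exists>n k. 1 \<le> k \<and> k \<le> 2 ^ n \<and> i = 2 + k + (\<Sum>j<n. 2 ^ j) \<and> p = apex \<epsilon> n k))"

definition rho :: "real \<Rightarrow> nat \<Rightarrow> real" where
  "rho \<epsilon> i = 4 powi (1 - int i) * (1 / 4 * 2 powi (- 7) * sqrt (1 + 7 * 16 * \<epsilon>\<^sup>2))"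

text \<open>
  The level \<open>n\<close> of an index \<open>i \<ge> 3\<close> used for the radii is not the level of the cap whose apex is
  \<open>e_pt \<epsilon> i\<close>: that cap has level \<open>n\<close> if \<open>i = 2 + (\<Sum>j\<le>n. 2 ^ j)\<close> and level \<open>n + 1\<close> otherwise.
\<close>

definition radius_level :: "nat \<Rightarrow> nat" where
  "radius_level i = (THE n. 2 + (\<Sum>j\<le>n. 2 ^ j) \<le> i \<and> i \<le> 1 + (\<Sum>j\<le>n + 1. 2 ^ j))"

text \<open>
  With truncated subtraction, \<open>{n - 2..<n}\<close> consists of those of \<open>n - 1\<close> and \<open>n - 2\<close> that are
  nonnegative. The case \<open>n = 0\<close> is separate because \<^term>\<open>infdist x {} = 0\<close>.
\<close>

definition radius :: "real \<Rightarrow> nat \<Rightarrow> real" where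
  "radius \<epsilon> i =
     (if i \<le> 2 then rho \<epsilon> i
      else let n = radius_level i
           in if n = 0 then rho \<epsilon> i
              else min (rho \<epsilon> i)
                     (1 / 2 * infdist (e_pt \<epsilon> i) (\<Union>m\<in>{n - 2..<n}. A_curve \<epsilon> m)))"

definition calA_eps :: "real \<Rightarrow> point set" where
  "calA_eps \<epsilon> = A_eps \<epsilon> - (\<Union>i\<in>{1..}. ball (e_pt \<epsilon> i) (radius \<epsilon> i))"

end

theory Submission
  imports Defs
begin

text \<open>
  A cap erected on an edge of its parent meets the base of the parent in one endpoint only, and the
  two caps erected in the same parent are separated by the perpendicular bisector of its base, which
  they touch only in the apex. By induction, different caps of the same level share at most
  endpoints of their bases, so a point of \<open>A\<^sub>n\<close> that is not a vertex lies in no cap of level \<open>n + 1\<close>.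
  As the closure of all curves is contained in the union of the caps of level \<open>n + 1\<close> and the curves
  \<open>A\<^sub>1, \<dots>, A\<^sub>n\<^sub>+\<^sub>1\<close>, such a point has a neighbourhood that does not meet \<open>A\<^sub>\<epsilon>\<close>. The vertices are the
  centres of the removed balls, whose radii are positive because a new apex lies on no earlier curve.
\<close>

section \<open>Solid triangles and orthogonality in the plane\<close>

lemma mem_triangle_iff:
  "x \<in> triangle a b p \<longleftrightarrow>
     (\<exists>u v w. 0 \<le> u \<and> 0 \<le> v \<and> 0 \<le> w \<and> u + v + w = 1 \<and> x = u *\<^sub>R a + v *\<^sub>R b + w *\<^sub>R p)"
  unfolding triangle_def convex_hull_3 by blast

lemma triangle_commute: "triangle a b p = triangle b a p"
  by (simp add: triangle_def insert_commute)

lemma triangle_vertices: "a \<in> triangle a b p" "b \<in> triangle a b p" "p \<in> triangle a b p"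
  unfolding triangle_def by (auto intro: hull_inc)

lemma triangle_subset:
  assumes "x \<in> triangle a b p" "y \<in> triangle a b p" "z \<in> triangle a b p"
  shows "triangle x y z \<subseteq> triangle a b p"
  using assms unfolding triangle_def by (intro hull_minimal) auto

lemma closed_segment_subset_triangle: "closed_segment a b \<subseteq> triangle a b p"
  unfolding triangle_def segment_convex_hull by (intro hull_mono) auto

lemma closed_triangle: "closed (triangle a b p)"
  unfolding triangle_def by (simp add: compact_imp_closed finite_imp_compact_convex_hull)

lemma is_cap_apex_commute: "is_cap_apex h a b p \<longleftrightarrow> is_cap_apex h b a p"
proof -
  have "orthogonal c (b - a) \<longleftrightarrow> orthogonal c (a - b)" for c
    by (auto simp: orthogonal_def inner_diff_right)
  then show ?thesis by (simp add: is_cap_apex_def midpoint_sym)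
qed

text \<open>The orthogonal complement of a nonzero vector in the plane is a line. Eliminating
  \<open>z\<close> from the two equations shows that both coordinates of \<open>z\<close> annihilate
  the determinant of \<open>x\<close> and \<open>y\<close>.\<close>

lemma orthogonal_plane_collinear:
  fixes x y z :: "real^2"
  assumes "x \<bullet> z = 0" "y \<bullet> z = 0" "y \<noteq> 0" "z \<noteq> 0"
  obtains \<mu> where "x = \<mu> *\<^sub>R y"
proof -
  have x: "x $ 1 * z $ 1 + x $ 2 * z $ 2 = 0" and y: "y $ 1 * z $ 1 + y $ 2 * z $ 2 = 0"
    using assms by (simp_all add: inner_vec_def sum_2)
  have "y $ 1 \<noteq> 0 \<or> y $ 2 \<noteq> 0" "z $ 1 \<noteq> 0 \<or> z $ 2 \<noteq> 0"
    using assms by (auto simp: vec_eq_iff forall_2)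
  moreover have "z $ 1 * (x $ 1 * y $ 2 - x $ 2 * y $ 1) = 0" "z $ 2 * (x $ 1 * y $ 2 - x $ 2 * y $ 1) = 0"
    using x y by algebra+
  ultimately have det: "x $ 1 * y $ 2 = x $ 2 * y $ 1" by auto
  show thesis
  proof (cases "y $ 1 = 0")
    case True
    then have "y $ 2 \<noteq> 0" using \<open>y $ 1 \<noteq> 0 \<or> y $ 2 \<noteq> 0\<close> by simp
    then have "x = (x $ 2 / y $ 2) *\<^sub>R y"
      using det by (auto simp: vec_eq_iff forall_2 field_simps)
    then show thesis by (rule that)
  next
    case False
    then have "x = (x $ 1 / y $ 1) *\<^sub>R y"
      using det by (auto simp: vec_eq_iff forall_2 field_simps)
    then show thesis by (rule that)
  qed
qed

section \<open>A single cap and its natural frame \<open>d\<close>, \<open>c\<close>\<close>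

locale cap =
  fixes h :: real and a b p :: point
  assumes apex: "is_cap_apex h a b p" and height_pos: "0 < h" and flat: "2 * h < norm (b - a)"
begin

definition d :: point where "d = b - a"
definition c :: point where "c = p - midpoint a b"
text \<open>
  \<open>w\<close> is perpendicular to the edge from \<open>a\<close> to \<open>p\<close> and points to the inside of the cap, so that the
  apex of the cap erected on this edge is the midpoint plus a positive multiple of \<open>w\<close>.
\<close>

definition w :: point where "w = (2 * h\<^sup>2) *\<^sub>R d - (norm d)\<^sup>2 *\<^sub>R c"

lemma c_inner_d: "c \<bullet> d = 0" "d \<bullet> c = 0" and c_norm: "norm c = h"
  using apex by (auto simp: is_cap_apex_def c_def d_def orthogonal_def inner_commute)

lemma d_inner_d: "d \<bullet> d = (norm d)\<^sup>2" and c_inner_c: "c \<bullet> c = h\<^sup>2"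
  using c_norm by (auto simp: power2_norm_eq_inner)

lemma norm_d: "2 * h < norm d"
  using flat by (simp add: d_def)

lemma norm_d_sq: "4 * h\<^sup>2 < (norm d)\<^sup>2"
proof -
  have "(2 * h)\<^sup>2 < (norm d)\<^sup>2"
    using norm_d height_pos by (intro power_strict_mono) auto
  then show ?thesis by (simp add: power_mult_distrib)
qed

lemma p_minus_a: "p - a = (1/2) *\<^sub>R d + c"
  by (simp add: c_def d_def midpoint_def vec_eq_iff field_simps)

lemma commute: "cap h b a p"
  using apex height_pos flat
  by unfold_locales (auto simp: is_cap_apex_commute norm_minus_commute)

text \<open>For a cap of height \<open>h / 2\<close> on this edge the inequality is exactly
  \<open>flat\<close>, so flatness passes from each level to the next. By Pythagoras the squared
  edge is a quarter of the squared base plus the squared height.\<close>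

lemma norm_edge: "h < norm (p - a)"
proof -
  have "(norm (p - a))\<^sup>2 = (norm d)\<^sup>2 / 4 + h\<^sup>2"
    unfolding p_minus_a power2_norm_eq_inner
    by (simp add: inner_add_left inner_add_right c_inner_d c_inner_c d_inner_d)
  then have "h\<^sup>2 < (norm (p - a))\<^sup>2"
    using norm_d_sq zero_le_power2[of h] by linarith
  then show ?thesis by (rule power_less_imp_less_base) simp
qed

lemma w_inner: "w \<bullet> d = 2 * h\<^sup>2 * (norm d)\<^sup>2" "w \<bullet> c = - ((norm d)\<^sup>2 * h\<^sup>2)"
    "w \<bullet> w = h\<^sup>2 * (norm d)\<^sup>2 * (4 * h\<^sup>2 + (norm d)\<^sup>2)"
  by (simp_all add: w_def inner_diff_left inner_diff_right c_inner_d c_inner_c d_inner_d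
      algebra_simps power2_eq_square)

lemma w_orthogonal_edge: "w \<bullet> (p - a) = 0"
  by (simp add: p_minus_a inner_add_right w_inner)

lemma w_nonzero: "w \<noteq> 0" and w_inner_pos: "0 < w \<bullet> w"
proof -
  have "0 < (norm d)\<^sup>2" "0 < h\<^sup>2" using norm_d_sq height_pos by (auto intro: le_less_trans[of 0 "4 * h\<^sup>2"])
  then show "0 < w \<bullet> w" unfolding w_inner by (intro mult_pos_pos add_pos_pos) auto
  then show "w \<noteq> 0" by auto
qed

text \<open>Comparing squared norms gives
  \<open>\<mu>\<^sup>2 * (L * (4 * h\<^sup>2 + L)) = 1 / 4\<close> with \<open>L\<close> the squared
  base, and dropping the term \<open>4 * h\<^sup>2\<close> leaves a strict bound. It makes the
  coefficient of \<open>c\<close> in \<open>edge_apex_eq\<close> positive: the new apex stays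
  strictly above the base of the parent.\<close>

lemma offset_coefficient_bound:
  assumes "norm (\<mu> *\<^sub>R w) = h / 2"
  shows "\<mu> * (norm d)\<^sup>2 < 1 / 2"
proof -
  define L where "L = (norm d)\<^sup>2"
  have "(norm (\<mu> *\<^sub>R w))\<^sup>2 = \<mu>\<^sup>2 * (w \<bullet> w)"
    by (simp add: power_mult_distrib power2_norm_eq_inner)
  then have "\<mu>\<^sup>2 * (h\<^sup>2 * L * (4 * h\<^sup>2 + L)) = (h / 2)\<^sup>2"
    unfolding assms w_inner L_def by simp
  then have "h\<^sup>2 * (\<mu>\<^sup>2 * (L * (4 * h\<^sup>2 + L))) = h\<^sup>2 * (1 / 4)" by (simp add: algebra_simps power_divide)
  then have eq: "\<mu>\<^sup>2 * (L * (4 * h\<^sup>2 + L)) = 1 / 4"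
    using height_pos mult_left_cancel[of "h\<^sup>2"] by fastforce
  then have "\<mu> \<noteq> 0" by auto
  have "0 < L" using norm_d_sq zero_le_power2[of h] unfolding L_def by linarith
  have "(\<mu> * L)\<^sup>2 < (1 / 2)\<^sup>2"
  proof -
    have "L * L < L * (4 * h\<^sup>2 + L)"
      using \<open>0 < L\<close> height_pos by (intro mult_strict_left_mono) auto
    then have "\<mu>\<^sup>2 * (L * L) < \<mu>\<^sup>2 * (L * (4 * h\<^sup>2 + L))"
      using \<open>\<mu> \<noteq> 0\<close> by - (rule mult_strict_left_mono, assumption, simp)
    with eq show ?thesis by (simp add: power2_eq_square algebra_simps)
  qed
  then show ?thesis unfolding L_def by (rule power_less_imp_less_base) simp
qed

text \<open>Flatness trades the squared base of the previous bound for \<open>4 * h\<^sup>2\<close>.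
  This keeps the coefficient of \<open>d\<close> in \<open>edge_apex_eq\<close> below 1/2, so the
  new apex stays on the side of \<open>a\<close> of the perpendicular bisector.\<close>

lemma offset_coefficient_bound':
  assumes "norm (\<mu> *\<^sub>R w) = h / 2" "0 \<le> \<mu>"
  shows "\<mu> * h\<^sup>2 < 1 / 8"
proof -
  have "\<mu> * (4 * h\<^sup>2) \<le> \<mu> * (norm d)\<^sup>2"
    using norm_d_sq assms by (intro mult_left_mono) auto
  with offset_coefficient_bound[OF assms(1)] show ?thesis by simp
qed

lemma edge_apex_eq:
  "midpoint a p + \<mu> *\<^sub>R w =
     a + (1/4 + 2 * \<mu> * h\<^sup>2) *\<^sub>R d + (1/2 - \<mu> * (norm d)\<^sup>2) *\<^sub>R c"
proof -
  have "midpoint a p = a + (1/4) *\<^sub>R d + (1/2) *\<^sub>R c"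
  proof -
    have "midpoint a p = a + (1/2) *\<^sub>R (p - a)"
      by (simp add: midpoint_def vec_eq_iff field_simps)
    then show ?thesis unfolding p_minus_a by (simp add: scaleR_add_right)
  qed
  then show ?thesis by (simp add: w_def algebra_simps)
qed

lemma inward_apex_exists: "\<exists>q. is_cap_apex (h / 2) a p q \<and> triangle a p q \<subseteq> triangle a b p"
proof -
  define \<mu> where "\<mu> = h / 2 / norm w"
  have norm: "norm (\<mu> *\<^sub>R w) = h / 2" and "0 \<le> \<mu>"
    using height_pos w_nonzero by (auto simp: \<mu>_def)
  define q where "q = midpoint a p + \<mu> *\<^sub>R w"
  note bounds = offset_coefficient_bound[OF norm] offset_coefficient_bound'[OF norm \<open>0 \<le> \<mu>\<close>]
  define L where "L = (norm d)\<^sup>2"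
  \<comment> \<open>Barycentric weights of \<open>q\<close> with respect to \<open>b\<close> and
    \<open>p\<close>: \<open>\<gamma>\<close> is the coefficient of \<open>c\<close> in
    \<open>edge_apex_eq\<close>, and \<open>\<beta>\<close> is what remains of the coefficient of
    \<open>d\<close> after \<open>p\<close> has contributed \<open>\<gamma> / 2\<close>.\<close>
  define \<gamma> where "\<gamma> = 1/2 - \<mu> * L"
  define \<beta> where "\<beta> = 2 * \<mu> * h\<^sup>2 + \<mu> * L / 2"
  have "0 \<le> \<mu> * L" "0 \<le> \<mu> * h\<^sup>2" using \<open>0 \<le> \<mu>\<close> by (auto simp: L_def)
  then have "0 \<le> \<gamma>" "0 \<le> \<beta>" "0 \<le> 1 - \<beta> - \<gamma>"
    using bounds unfolding \<gamma>_def \<beta>_def L_def by linarith+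
  moreover have "q = (1 - \<beta> - \<gamma>) *\<^sub>R a + \<beta> *\<^sub>R b + \<gamma> *\<^sub>R p"
  proof -
    have "q = a + (\<beta> + \<gamma> / 2) *\<^sub>R d + \<gamma> *\<^sub>R c"
    proof -
      have "1/4 + 2 * \<mu> * h\<^sup>2 = \<beta> + \<gamma> / 2" by (simp add: \<beta>_def \<gamma>_def field_simps)
      then show ?thesis unfolding q_def edge_apex_eq by (simp add: \<gamma>_def L_def)
    qed
    also have "\<dots> = a + \<beta> *\<^sub>R d + \<gamma> *\<^sub>R (p - a)"
      unfolding p_minus_a by (simp add: algebra_simps)
    finally show ?thesis by (simp add: d_def algebra_simps)
  qed
  ultimately have "q \<in> triangle a b p"
    unfolding mem_triangle_iff
    by (intro exI[of _ "1 - \<beta> - \<gamma>"] exI[of _ \<beta>] exI[of _ \<gamma>]) simp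
  then have "triangle a p q \<subseteq> triangle a b p"
    by (intro triangle_subset triangle_vertices)
  moreover have "is_cap_apex (h / 2) a p q"
    unfolding is_cap_apex_def using norm w_orthogonal_edge
    by (intro exI[of _ "\<mu> *\<^sub>R w"]) (simp add: q_def orthogonal_def)
  ultimately show ?thesis by blast
qed

lemma apex_notin_base: "p \<notin> closed_segment a b"
proof
  assume "p \<in> closed_segment a b"
  then obtain u where "p = (1 - u) *\<^sub>R a + u *\<^sub>R b" by (auto simp: in_segment)
  then have "p - a = u *\<^sub>R d" by (simp add: d_def algebra_simps)
  \<comment> \<open>The inner product with \<open>c\<close> measures the height above the base: it
    vanishes on the base but equals \<open>h\<^sup>2\<close> at the apex.\<close>
  then have "(p - a) \<bullet> c = 0" by (simp add: c_inner_d)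
  then show False using height_pos by (simp add: p_minus_a inner_add_left c_inner_d c_inner_c)
qed

end

text \<open>Only the edge from \<open>a\<close> to \<open>p\<close> is treated. The other edge is
  covered by the same locale with \<open>a\<close> and \<open>b\<close> exchanged, since
  \<open>cap\<close> is symmetric in them.\<close>

locale child_cap = cap +
  fixes q :: point
  assumes child_apex: "is_cap_apex (h / 2) a p q" and child_subset: "triangle a p q \<subseteq> triangle a b p"
begin

text \<open>Inclusion in the parent decides between the two candidate apices: the parent lies in the
  half-plane beyond its edge into which \<open>w\<close> points, which forces
  \<open>0 \<le> \<mu>\<close>. The two offset bounds then apply.\<close>

lemma child_apex_coordinates:
  obtains s t where "q = a + s *\<^sub>R d + t *\<^sub>R c" "s < 1 / 2" "0 < t"
proof -
  obtain c' where c': "norm c' = h / 2" "c' \<bullet> (p - a) = 0" "q = midpoint a p + c'"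
    using child_apex by (auto simp: is_cap_apex_def orthogonal_def)
  have "p - a \<noteq> 0" using norm_edge height_pos by auto
  then obtain \<mu> where \<mu>: "c' = \<mu> *\<^sub>R w"
    using orthogonal_plane_collinear[OF c'(2) w_orthogonal_edge w_nonzero] by blast
  have "q \<in> triangle a b p" using child_subset triangle_vertices by blast
  then obtain x y z where xyz: "0 \<le> y" "x + y + z = 1" "q = x *\<^sub>R a + y *\<^sub>R b + z *\<^sub>R p"
    unfolding mem_triangle_iff by blast
  have x: "x = 1 - y - z" using xyz(2) by simp
  have "q - a = y *\<^sub>R d + z *\<^sub>R (p - a)"
    unfolding xyz(3) d_def x by (simp add: algebra_simps)
  \<comment> \<open>Since \<open>w\<close> is orthogonal to the edge, only the weight
    \<open>y\<close> of \<open>b\<close> contributes.\<close>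
  then have "w \<bullet> (q - a) = y * (w \<bullet> d)" by (simp add: inner_add_right w_orthogonal_edge)
  then have "0 \<le> w \<bullet> (q - a)" using xyz(1) by (simp add: w_inner)
  moreover have "w \<bullet> (q - a) = \<mu> * (w \<bullet> w)"
  proof -
    have "q - a = (1/2) *\<^sub>R (p - a) + \<mu> *\<^sub>R w"
      unfolding c'(3) \<mu> midpoint_def by (simp add: vec_eq_iff algebra_simps)
    then show ?thesis by (simp add: inner_add_right w_orthogonal_edge)
  qed
  ultimately have "0 \<le> \<mu>" using w_inner_pos by (simp add: zero_le_mult_iff)
  have norm: "norm (\<mu> *\<^sub>R w) = h / 2" using c' \<mu> by simp
  show thesis
  proof (rule that)
    show "q = a + (1/4 + 2 * \<mu> * h\<^sup>2) *\<^sub>R d + (1/2 - \<mu> * (norm d)\<^sup>2) *\<^sub>R c"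
      unfolding c'(3) \<mu> by (rule edge_apex_eq)
  qed (use offset_coefficient_bound[OF norm] offset_coefficient_bound'[OF norm \<open>0 \<le> \<mu>\<close>] in auto)
qed

text \<open>The height above the base is zero at \<open>a\<close> and positive at \<open>p\<close>
  and \<open>q\<close>. A convex combination of height zero therefore puts all its weight on
  \<open>a\<close>.\<close>

lemma child_inter_base: "triangle a p q \<inter> closed_segment a b \<subseteq> {a}"
proof
  fix x assume x: "x \<in> triangle a p q \<inter> closed_segment a b"
  obtain s t where q: "q = a + s *\<^sub>R d + t *\<^sub>R c" "0 < t"
    using child_apex_coordinates by blast
  from x obtain u v r where uvr: "0 \<le> v" "0 \<le> r" "u + v + r = 1" "x = u *\<^sub>R a + v *\<^sub>R p + r *\<^sub>R q"
    unfolding mem_triangle_iff Int_iff by blast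
  from x obtain y where "x = (1 - y) *\<^sub>R a + y *\<^sub>R b" by (auto simp: in_segment)
  then have "x - a = y *\<^sub>R d" by (simp add: d_def algebra_simps)
  then have "(x - a) \<bullet> c = 0" by (simp add: c_inner_d)
  moreover have u: "u = 1 - v - r" using uvr(3) by simp
  have "x - a = v *\<^sub>R (p - a) + r *\<^sub>R (q - a)" unfolding uvr(4) u by (simp add: algebra_simps)
  then have "(x - a) \<bullet> c = v * h\<^sup>2 + r * (t * h\<^sup>2)"
    by (simp add: p_minus_a q inner_add_left c_inner_d c_inner_c)
  moreover have "0 \<le> v * h\<^sup>2" "0 \<le> r * (t * h\<^sup>2)" using uvr(1,2) q(2) by auto
  ultimately have "v * h\<^sup>2 = 0" "r * (t * h\<^sup>2) = 0" by linarith+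
  then have "v = 0" "r = 0" using height_pos q(2) by auto
  then show "x \<in> {a}" using uvr(3,4) by simp
qed

text \<open>In direction \<open>d\<close> both \<open>a\<close> and \<open>q\<close> lie strictly
  behind \<open>p\<close>, because \<open>p\<close> is at half the base and
  \<open>s < 1 / 2\<close>. Any weight on them makes the inner product negative.\<close>

lemma child_side:
  assumes "x \<in> triangle a p q"
  shows "x = p \<or> (x - p) \<bullet> (b - a) < 0"
proof -
  obtain s t where q: "q = a + s *\<^sub>R d + t *\<^sub>R c" "s < 1 / 2"
    using child_apex_coordinates by blast
  define L where "L = (norm d)\<^sup>2"
  have "0 < L" using norm_d_sq zero_le_power2[of h] unfolding L_def by linarith
  obtain u v r where uvr: "0 \<le> u" "0 \<le> r" "u + v + r = 1" "x = u *\<^sub>R a + v *\<^sub>R p + r *\<^sub>R q"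
    using assms unfolding mem_triangle_iff by blast
  have v: "v = 1 - u - r" using uvr(3) by simp
  have "x - p = r *\<^sub>R (q - a) - (u + r) *\<^sub>R (p - a)" unfolding uvr(4) v by (simp add: algebra_simps)
  then have "(x - p) \<bullet> d = r * ((q - a) \<bullet> d) - (u + r) * ((p - a) \<bullet> d)"
    by (simp only: inner_diff_left inner_scaleR_left)
  also have "(q - a) \<bullet> d = s * L"
    unfolding q(1) by (simp add: inner_add_left c_inner_d d_inner_d L_def)
  also have "(p - a) \<bullet> d = L / 2"
    unfolding p_minus_a by (simp add: inner_add_left c_inner_d d_inner_d L_def)
  also have "r * (s * L) - (u + r) * (L / 2) = - (u * (L / 2) + r * ((1 / 2 - s) * L))"
    by (simp add: algebra_simps)
  finally have eq: "(x - p) \<bullet> d = - (u * (L / 2) + r * ((1 / 2 - s) * L))" .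
  show ?thesis
  proof (cases "u = 0 \<and> r = 0")
    case True
    then show ?thesis using uvr(3,4) by simp
  next
    case False
    have "0 \<le> u * (L / 2)" "0 \<le> r * ((1 / 2 - s) * L)" using uvr(1,2) q(2) \<open>0 < L\<close> by auto
    moreover have "0 < u * (L / 2) \<or> 0 < r * ((1 / 2 - s) * L)"
      using False uvr(1,2) q(2) \<open>0 < L\<close> by auto
    ultimately show ?thesis using eq by (auto simp: d_def)
  qed
qed

end

section \<open>The levels of the construction\<close>

definition left_end :: "real \<Rightarrow> nat \<Rightarrow> nat \<Rightarrow> point" where
  "left_end \<epsilon> n i = fst (cap_data \<epsilon> n i)"

definition right_end :: "real \<Rightarrow> nat \<Rightarrow> nat \<Rightarrow> point" where
  "right_end \<epsilon> n i = fst (snd (cap_data \<epsilon> n i))"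

definition solid_cap :: "real \<Rightarrow> nat \<Rightarrow> nat \<Rightarrow> point set" where
  "solid_cap \<epsilon> n i = triangle (left_end \<epsilon> n i) (right_end \<epsilon> n i) (apex \<epsilon> n i)"

definition ends :: "real \<Rightarrow> nat \<Rightarrow> nat \<Rightarrow> point set" where
  "ends \<epsilon> n i = {left_end \<epsilon> n i, right_end \<epsilon> n i}"

definition vertices :: "real \<Rightarrow> nat \<Rightarrow> point set" where
  "vertices \<epsilon> n = (\<Union>i\<in>{1..2 ^ n}. ends \<epsilon> n i)"

lemma cap_data_eq: "cap_data \<epsilon> n i = (left_end \<epsilon> n i, right_end \<epsilon> n i, apex \<epsilon> n i)"
  by (simp add: left_end_def right_end_def apex_def)

lemma A_seg_eq: "A_seg \<epsilon> n i = closed_segment (left_end \<epsilon> n i) (right_end \<epsilon> n i)"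
  by (simp add: A_seg_def left_end_def right_end_def)

lemma ends_subset_A_seg: "ends \<epsilon> n i \<subseteq> A_seg \<epsilon> n i"
  by (simp add: ends_def A_seg_eq)

lemma A_seg_subset_solid_cap: "A_seg \<epsilon> n i \<subseteq> solid_cap \<epsilon> n i"
  by (simp add: A_seg_eq solid_cap_def closed_segment_subset_triangle)

lemma apex_in_solid_cap: "apex \<epsilon> n i \<in> solid_cap \<epsilon> n i"
  by (simp add: solid_cap_def triangle_vertices)

lemma closed_A_curve: "closed (A_curve \<epsilon> n)"
  by (auto simp: A_curve_def A_seg_def intro!: closed_UN)

lemma ends_0: "left_end \<epsilon> 0 i = vector [0, 0]" "right_end \<epsilon> 0 i = vector [1, 0]"
  by (simp_all add: left_end_def right_end_def Let_def)

lemma ends_Suc: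
  "left_end \<epsilon> (Suc n) i =
     (if odd i then left_end \<epsilon> n ((i + 1) div 2) else apex \<epsilon> n ((i + 1) div 2))"
  "right_end \<epsilon> (Suc n) i =
     (if odd i then apex \<epsilon> n ((i + 1) div 2) else right_end \<epsilon> n ((i + 1) div 2))"
  by (simp_all add: left_end_def right_end_def apex_def Let_def split: prod.split)

lemma apex_0:
  "apex \<epsilon> 0 i =
     (SOME p. is_cap_apex (cap_height \<epsilon> 0) (left_end \<epsilon> 0 i) (right_end \<epsilon> 0 i) p \<and> p $ 2 > 0)"
  by (simp add: apex_def ends_0 Let_def)

lemma apex_Suc:
  "apex \<epsilon> (Suc n) i =
     (SOME q. is_cap_apex (cap_height \<epsilon> (Suc n)) (left_end \<epsilon> (Suc n) i) (right_end \<epsilon> (Suc n) i) q \<and>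
        triangle (left_end \<epsilon> (Suc n) i) (right_end \<epsilon> (Suc n) i) q \<subseteq> solid_cap \<epsilon> n ((i + 1) div 2))"
  unfolding apex_def[of \<epsilon> "Suc n"] ends_Suc solid_cap_def
  by (simp add: cap_data_eq[of \<epsilon> n "Suc i div 2"])

lemma cap_height_0: "cap_height \<epsilon> 0 = 2 * \<epsilon>"
  by (simp add: cap_height_def)

lemma cap_height_Suc: "cap_height \<epsilon> (Suc n) = cap_height \<epsilon> n / 2"
proof -
  have "(2::real) powi (1 - int n) = 2 powi (1 - int (Suc n)) * 2 powi 1"
    by (subst power_int_add[symmetric]) auto
  then show ?thesis by (simp add: cap_height_def)
qed

lemma parent_in_range: "i \<in> {1..2 ^ Suc n} \<Longrightarrow> (i + 1) div 2 \<in> {1..2 ^ n}" for i :: nat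
  by auto

text \<open>Provides the uniqueness behind both definite descriptions, in \<open>e_pt\<close> and in
  \<open>radius_level\<close>.\<close>

lemma dyadic_level_unique:
  fixes m n i :: nat
  assumes "2 ^ m < i" "i \<le> 2 ^ Suc m" "2 ^ n < i" "i \<le> 2 ^ Suc n"
  shows "m = n"
proof -
  have "(2::nat) ^ m < 2 ^ Suc n" "(2::nat) ^ n < 2 ^ Suc m" using assms by linarith+
  then have "m < Suc n" "n < Suc m" by (meson power_less_imp_less_exp one_less_numeral_iff semiring_norm(76))+
  then show ?thesis by simp
qed

lemma sum_powers_of_two: "(\<Sum>j<n. (2::nat) ^ j) = 2 ^ n - 1"
  by (induction n) auto

section \<open>Validity of the chosen apices at every level\<close>

context
  fixes \<epsilon> :: real
  assumes \<epsilon>: "0 < \<epsilon>" "\<epsilon> < 1 / 100"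
begin

lemma cap_height_pos: "0 < cap_height \<epsilon> n"
  using \<epsilon> by (simp add: cap_height_def)

text \<open>The point (1/2, 2\<epsilon>) shows that the choice of the first apex is not vacuous.
  Flatness of this cap means 4\<epsilon> < 1, which follows from the upper bound on
  \<epsilon>.\<close>

lemma cap_level_0: "cap (cap_height \<epsilon> 0) (left_end \<epsilon> 0 i) (right_end \<epsilon> 0 i) (apex \<epsilon> 0 i)"
proof -
  have "is_cap_apex (cap_height \<epsilon> 0) (left_end \<epsilon> 0 i) (right_end \<epsilon> 0 i) (vector [1/2, 2 * \<epsilon>])
      \<and> (vector [1/2, 2 * \<epsilon>] :: point) $ 2 > 0"
    unfolding is_cap_apex_def ends_0 cap_height_0 using \<epsilon>
    by (auto intro!: exI[of _ "vector [0, 2 * \<epsilon>]"]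
        simp: norm_vec_def L2_set_def sum_2 orthogonal_def inner_vec_def midpoint_def vec_eq_iff forall_2
          power_mult_distrib real_sqrt_mult)
  then have "is_cap_apex (cap_height \<epsilon> 0) (left_end \<epsilon> 0 i) (right_end \<epsilon> 0 i) (apex \<epsilon> 0 i)"
    unfolding apex_0 by (metis (mono_tags, lifting) someI)
  moreover have "norm (right_end \<epsilon> 0 i - left_end \<epsilon> 0 i) = 1"
    by (simp add: ends_0 norm_vec_def L2_set_def sum_2)
  ultimately show ?thesis using \<epsilon> by unfold_locales (auto simp: cap_height_0)
qed

lemma cap_level_Suc:
  assumes "cap (cap_height \<epsilon> n) (left_end \<epsilon> n ((i + 1) div 2)) (right_end \<epsilon> n ((i + 1) div 2)) (apex \<epsilon> n ((i + 1) div 2))"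
  shows "cap (cap_height \<epsilon> (Suc n)) (left_end \<epsilon> (Suc n) i) (right_end \<epsilon> (Suc n) i) (apex \<epsilon> (Suc n) i)"
    and "solid_cap \<epsilon> (Suc n) i \<subseteq> solid_cap \<epsilon> n ((i + 1) div 2)"
proof -
  define a b p where "a = left_end \<epsilon> n ((i + 1) div 2)" and "b = right_end \<epsilon> n ((i + 1) div 2)"
    and "p = apex \<epsilon> n ((i + 1) div 2)"
  interpret cap "cap_height \<epsilon> n" a b p using assms by (simp add: a_def b_def p_def)
  interpret swapped: cap "cap_height \<epsilon> n" b a p by (rule commute)
  have "\<exists>q. is_cap_apex (cap_height \<epsilon> (Suc n)) (left_end \<epsilon> (Suc n) i) (right_end \<epsilon> (Suc n) i) q \<and>
        triangle (left_end \<epsilon> (Suc n) i) (right_end \<epsilon> (Suc n) i) q \<subseteq> solid_cap \<epsilon> n ((i + 1) div 2)"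
    unfolding ends_Suc solid_cap_def cap_height_Suc a_def[symmetric] b_def[symmetric] p_def[symmetric]
    \<comment> \<open>For odd \<open>i\<close> the base is the edge from \<open>a\<close> to
      \<open>p\<close>; for even \<open>i\<close> it is the edge from \<open>p\<close> to
      \<open>b\<close>, handled by the swapped cap with its base reversed.\<close>
    using inward_apex_exists swapped.inward_apex_exists
    by (auto simp: is_cap_apex_commute[of _ p b] triangle_commute[of p b] triangle_commute[of b a])
  from someI_ex[OF this]
  have apex: "is_cap_apex (cap_height \<epsilon> (Suc n)) (left_end \<epsilon> (Suc n) i) (right_end \<epsilon> (Suc n) i) (apex \<epsilon> (Suc n) i)"
    and sub: "solid_cap \<epsilon> (Suc n) i \<subseteq> solid_cap \<epsilon> n ((i + 1) div 2)"
    unfolding apex_Suc[symmetric] solid_cap_def[of _ "Suc n"] by auto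
  have "2 * cap_height \<epsilon> (Suc n) < norm (right_end \<epsilon> (Suc n) i - left_end \<epsilon> (Suc n) i)"
    unfolding ends_Suc cap_height_Suc a_def[symmetric] b_def[symmetric] p_def[symmetric]
    using norm_edge swapped.norm_edge by (auto simp: norm_minus_commute)
  then show "cap (cap_height \<epsilon> (Suc n)) (left_end \<epsilon> (Suc n) i) (right_end \<epsilon> (Suc n) i) (apex \<epsilon> (Suc n) i)"
    using apex cap_height_pos by unfold_locales auto
  show "solid_cap \<epsilon> (Suc n) i \<subseteq> solid_cap \<epsilon> n ((i + 1) div 2)" by (rule sub)
qed

text \<open>The index is unrestricted: the recursion halves any \<open>i\<close> down to level 0,
  where the data do not depend on it. No range condition has to be carried through the
  induction.\<close>

lemma cap_all: "cap (cap_height \<epsilon> n) (left_end \<epsilon> n i) (right_end \<epsilon> n i) (apex \<epsilon> n i)"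
  by (induction n arbitrary: i) (auto intro: cap_level_0 cap_level_Suc(1))

lemma solid_cap_subset_parent: "solid_cap \<epsilon> (Suc n) i \<subseteq> solid_cap \<epsilon> n ((i + 1) div 2)"
  using cap_all by (rule cap_level_Suc(2))

lemma child_cap_odd:
  assumes "odd i"
  shows "child_cap (cap_height \<epsilon> n) (left_end \<epsilon> n ((i + 1) div 2)) (right_end \<epsilon> n ((i + 1) div 2))
    (apex \<epsilon> n ((i + 1) div 2)) (apex \<epsilon> (Suc n) i)"
proof -
  interpret cap "cap_height \<epsilon> (Suc n)" "left_end \<epsilon> (Suc n) i" "right_end \<epsilon> (Suc n) i" "apex \<epsilon> (Suc n) i"
    by (rule cap_all)
  show ?thesis
    using apex solid_cap_subset_parent[of n i] assms
    by (intro child_cap.intro cap_all) (auto simp: child_cap_axioms_def ends_Suc cap_height_Suc solid_cap_def)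
qed

lemma child_cap_even:
  assumes "even i"
  shows "child_cap (cap_height \<epsilon> n) (right_end \<epsilon> n ((i + 1) div 2)) (left_end \<epsilon> n ((i + 1) div 2))
    (apex \<epsilon> n ((i + 1) div 2)) (apex \<epsilon> (Suc n) i)"
proof -
  interpret cap "cap_height \<epsilon> (Suc n)" "left_end \<epsilon> (Suc n) i" "right_end \<epsilon> (Suc n) i" "apex \<epsilon> (Suc n) i"
    by (rule cap_all)
  show ?thesis
    using apex solid_cap_subset_parent[of n i] assms
    by (intro child_cap.intro cap.commute[OF cap_all])
      (auto simp: child_cap_axioms_def ends_Suc cap_height_Suc solid_cap_def
        is_cap_apex_commute[of _ "right_end \<epsilon> n _"] triangle_commute[of "right_end \<epsilon> n _"])
qed

section \<open>Intersections of caps and base segments\<close>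

lemma solid_cap_inter_parent_base:
  "solid_cap \<epsilon> (Suc n) i \<inter> A_seg \<epsilon> n ((i + 1) div 2) \<subseteq> ends \<epsilon> n ((i + 1) div 2)"
proof (cases "odd i")
  case True
  then show ?thesis using child_cap.child_inter_base[OF child_cap_odd, of i n]
    by (auto simp: solid_cap_def ends_def A_seg_eq ends_Suc)
next
  case False
  then show ?thesis using child_cap.child_inter_base[OF child_cap_even, of i n]
    by (auto simp: solid_cap_def ends_def A_seg_eq ends_Suc closed_segment_commute[of "right_end \<epsilon> n _"]
        triangle_commute[of "right_end \<epsilon> n _"])
qed

text \<open>Away from the common apex, \<open>child_side\<close> puts the two siblings strictly on
  opposite sides of the perpendicular bisector of the parent's base.\<close>

lemma siblings_inter:
  assumes "(i + 1) div 2 = (j + 1) div 2" "i \<noteq> j"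
    "x \<in> solid_cap \<epsilon> (Suc n) i" "x \<in> solid_cap \<epsilon> (Suc n) j"
  shows "x = apex \<epsilon> n ((i + 1) div 2)"
proof -
  have *: "x = apex \<epsilon> n ((i + 1) div 2)"
    if "odd i" "even j" "(i + 1) div 2 = (j + 1) div 2"
      "x \<in> solid_cap \<epsilon> (Suc n) i" "x \<in> solid_cap \<epsilon> (Suc n) j" for i j
  proof (rule ccontr)
    define a b p where "a = left_end \<epsilon> n ((i + 1) div 2)" and "b = right_end \<epsilon> n ((i + 1) div 2)"
      and "p = apex \<epsilon> n ((i + 1) div 2)"
    assume "x \<noteq> apex \<epsilon> n ((i + 1) div 2)"
    moreover have "x \<in> triangle a p (apex \<epsilon> (Suc n) i)" "x \<in> triangle b p (apex \<epsilon> (Suc n) j)"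
      using that(1,2,4,5) unfolding solid_cap_def ends_Suc a_def b_def p_def that(3)
      by (simp_all add: triangle_commute[of "right_end \<epsilon> n _"])
    ultimately have "(x - p) \<bullet> (b - a) < 0" "(x - p) \<bullet> (a - b) < 0"
      using child_cap.child_side[OF child_cap_odd[OF that(1)], of x n]
        child_cap.child_side[OF child_cap_even[OF that(2)], of x n, folded that(3)]
      unfolding a_def b_def p_def by blast+
    then show False by (simp add: inner_diff_right)
  qed
  have "odd i \<noteq> odd j" using assms(1,2) by presburger
  then show ?thesis using *[of i j] *[of j i] assms by auto
qed

lemma apex_notin_A_seg: "apex \<epsilon> n i \<notin> A_seg \<epsilon> n i"
  using cap.apex_notin_base[OF cap_all] by (simp add: A_seg_eq)

text \<open>Each end of the parent's base is an end of exactly one child. If the other child also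
  contained it, it would be the apex by \<open>siblings_inter\<close>, but the apex is off the
  base.\<close>

lemma ends_parent_in_child:
  assumes "x \<in> ends \<epsilon> n ((i + 1) div 2)" "x \<in> solid_cap \<epsilon> (Suc n) i" "1 \<le> i"
  shows "x \<in> ends \<epsilon> (Suc n) i"
proof (rule ccontr)
  assume not: "x \<notin> ends \<epsilon> (Suc n) i"
  \<comment> \<open>The sibling of \<open>i\<close>. The assumption \<open>1 \<le> i\<close> matters
    here: for \<open>i = 0\<close> truncated subtraction would give \<open>j = i\<close>.\<close>
  define j where "j = (if odd i then i + 1 else i - 1)"
  have j: "(i + 1) div 2 = (j + 1) div 2" "i \<noteq> j" "odd i \<noteq> odd j"
    using assms(3) unfolding j_def by (auto elim!: oddE evenE)
  have "x \<in> ends \<epsilon> (Suc n) j"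
    using assms(1) not j by (auto simp: ends_def ends_Suc split: if_splits)
  then have "x \<in> solid_cap \<epsilon> (Suc n) j" using ends_subset_A_seg A_seg_subset_solid_cap by blast
  then have "x = apex \<epsilon> n ((i + 1) div 2)" using siblings_inter[OF j(1,2) assms(2)] by simp
  then show False using assms(1) ends_subset_A_seg apex_notin_A_seg by blast
qed

text \<open>Induction over levels. Siblings meet in the parent's apex, which is an end of both
  bases; for distinct parents the common point is an end of a parent base and is passed down by
  \<open>ends_parent_in_child\<close>.\<close>

lemma solid_caps_inter:
  assumes "i \<in> {1..2 ^ n}" "j \<in> {1..2 ^ n}" "i \<noteq> j" "x \<in> solid_cap \<epsilon> n i" "x \<in> solid_cap \<epsilon> n j"
  shows "x \<in> ends \<epsilon> n i"
  using assms
proof (induction n arbitrary: i j)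
  case 0
  then show ?case by auto
next
  case (Suc n)
  show ?case
  proof (cases "(i + 1) div 2 = (j + 1) div 2")
    case True
    then have "x = apex \<epsilon> n ((i + 1) div 2)" using siblings_inter Suc.prems by blast
    then show ?thesis by (simp add: ends_def ends_Suc)
  next
    case False
    then have "x \<in> ends \<epsilon> n ((i + 1) div 2)"
      using Suc.IH[OF parent_in_range parent_in_range False] Suc.prems solid_cap_subset_parent by blast
    then show ?thesis using ends_parent_in_child Suc.prems by simp
  qed
qed

text \<open>If the cap is a child of the segment's own cap, it meets the base only in an end.
  Otherwise its parent is another cap of level \<open>n\<close>, and \<open>solid_caps_inter\<close>
  applies.\<close>

lemma A_seg_inter_next_caps:
  assumes "i \<in> {1..2 ^ n}" "j \<in> {1..2 ^ Suc n}" "x \<in> A_seg \<epsilon> n i" "x \<in> solid_cap \<epsilon> (Suc n) j"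
  shows "x \<in> ends \<epsilon> n i"
proof (cases "(j + 1) div 2 = i")
  case True
  then show ?thesis using solid_cap_inter_parent_base assms by blast
next
  case False
  then show ?thesis
    using solid_caps_inter[OF assms(1) parent_in_range[OF assms(2)], of x] assms
      A_seg_subset_solid_cap solid_cap_subset_parent by blast
qed

section \<open>Vertices of the curves and their ancestors\<close>

lemma vertices_subset_A_curve: "vertices \<epsilon> n \<subseteq> A_curve \<epsilon> n"
  using ends_subset_A_seg by (fastforce simp: vertices_def A_curve_def)

lemma vertices_Suc: "vertices \<epsilon> n \<subseteq> vertices \<epsilon> (Suc n)"
proof
  fix x assume "x \<in> vertices \<epsilon> n"
  then obtain i where i: "i \<in> {1..2 ^ n}" "x \<in> ends \<epsilon> n i" by (auto simp: vertices_def)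
  have "2 * i - 1 + 1 = 2 * i" using i by simp
  then have "x \<in> ends \<epsilon> (Suc n) (2 * i - 1) \<or> x \<in> ends \<epsilon> (Suc n) (2 * i)"
    using i by (auto simp: ends_def ends_Suc)
  moreover have "2 * i - 1 \<in> {1..2 ^ Suc n}" "2 * i \<in> {1..2 ^ Suc n}" using i by auto
  ultimately show "x \<in> vertices \<epsilon> (Suc n)" unfolding vertices_def by blast
qed

lemma vertices_mono: "m \<le> n \<Longrightarrow> vertices \<epsilon> m \<subseteq> vertices \<epsilon> n"
  using lift_Suc_mono_le[of "vertices \<epsilon>"] vertices_Suc by blast

lemma vertices_cases:
  assumes "x \<in> vertices \<epsilon> n"
  shows "x = vector [0, 0] \<or> x = vector [1, 0] \<or> (\<exists>m k. k \<in> {1..2 ^ m} \<and> x = apex \<epsilon> m k)"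
  using assms
proof (induction n)
  case 0
  then show ?case by (auto simp: vertices_def ends_def ends_0)
next
  case (Suc n)
  then obtain i where i: "i \<in> {1..2 ^ Suc n}" "x \<in> ends \<epsilon> (Suc n) i" by (auto simp: vertices_def)
  then have "x \<in> ends \<epsilon> n ((i + 1) div 2) \<or> x = apex \<epsilon> n ((i + 1) div 2)"
    by (auto simp: ends_def ends_Suc split: if_splits)
  then show ?case using Suc.IH parent_in_range[OF i(1)] unfolding vertices_def by blast
qed

lemma solid_cap_subset_ancestor:
  assumes "m \<le> n" "i \<in> {1..2 ^ n}"
  shows "\<exists>j\<in>{1..2 ^ m}. solid_cap \<epsilon> n i \<subseteq> solid_cap \<epsilon> m j"
  using assms
proof (induction n arbitrary: i)
  case 0
  then show ?case by auto
next
  case (Suc n)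
  show ?case
  proof (cases "m = Suc n")
    case True
    then show ?thesis using Suc.prems by blast
  next
    case False
    then have "m \<le> n" using Suc.prems by simp
    then show ?thesis
      using Suc.IH[OF _ parent_in_range[OF Suc.prems(2)]] solid_cap_subset_parent[of n i] by blast
  qed
qed

text \<open>At its own level the apex could lie only on a foreign segment, hence would be an end of
  its own base. At an earlier level \<open>k\<close> it lies in a cap of level \<open>k + 1\<close>,
  so on that curve it would be a vertex; vertices persist to level \<open>m\<close>, which reduces
  to the first case.\<close>

lemma apex_notin_A_curve:
  assumes "k \<le> m" "i \<in> {1..2 ^ m}"
  shows "apex \<epsilon> m i \<notin> A_curve \<epsilon> k"
proof
  have same: "apex \<epsilon> m i \<notin> A_curve \<epsilon> m"
  proof
    assume "apex \<epsilon> m i \<in> A_curve \<epsilon> m"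
    then obtain j where j: "j \<in> {1..2 ^ m}" "apex \<epsilon> m i \<in> A_seg \<epsilon> m j" by (auto simp: A_curve_def)
    then have "i \<noteq> j" using apex_notin_A_seg by blast
    then have "apex \<epsilon> m i \<in> ends \<epsilon> m i"
      using solid_caps_inter[OF assms(2) j(1) _ apex_in_solid_cap] j A_seg_subset_solid_cap by blast
    then show False using ends_subset_A_seg apex_notin_A_seg by blast
  qed
  assume in_k: "apex \<epsilon> m i \<in> A_curve \<epsilon> k"
  with same have "k \<noteq> m" by auto
  then have "Suc k \<le> m" using assms by simp
  then obtain j where "j \<in> {1..2 ^ Suc k}" "apex \<epsilon> m i \<in> solid_cap \<epsilon> (Suc k) j"
    using solid_cap_subset_ancestor[of "Suc k" m i] assms apex_in_solid_cap by blast
  moreover obtain l where "l \<in> {1..2 ^ k}" "apex \<epsilon> m i \<in> A_seg \<epsilon> k l" using in_k by (auto simp: A_curve_def)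
  ultimately have "apex \<epsilon> m i \<in> vertices \<epsilon> k"
    using A_seg_inter_next_caps unfolding vertices_def by blast
  then show False using vertices_mono[OF assms(1)] vertices_subset_A_curve same by blast
qed

section \<open>The enumerated centres and the positivity of the radii\<close>

lemma e_pt_apex:
  assumes "k \<in> {1..2 ^ n}"
  shows "e_pt \<epsilon> (2 ^ n + 1 + k) = apex \<epsilon> n k"
proof -
  \<comment> \<open>Replacing the geometric sum by \<open>2 ^ m - 1\<close> and cancelling the
    constants gives an equation without truncated subtraction, to which
    \<open>dyadic_level_unique\<close> applies.\<close>
  have index: "2 ^ n + 1 + k = 2 + l + (\<Sum>j<m. 2 ^ j) \<longleftrightarrow> 2 ^ n + k = 2 ^ m + l" for l m :: nat
    using one_le_power[of "2::nat" m] unfolding sum_powers_of_two by auto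
  have "(THE p. \<exists>m l. 1 \<le> l \<and> l \<le> 2 ^ m \<and> 2 ^ n + 1 + k = 2 + l + (\<Sum>j<m. 2 ^ j) \<and> p = apex \<epsilon> m l)
      = apex \<epsilon> n k"
    unfolding index
  proof (rule the_equality)
    fix p assume "\<exists>m l. 1 \<le> l \<and> l \<le> 2 ^ m \<and> 2 ^ n + k = 2 ^ m + l \<and> p = apex \<epsilon> m l"
    then obtain m l where l: "1 \<le> l" "l \<le> 2 ^ m" "2 ^ n + k = 2 ^ m + l" "p = apex \<epsilon> m l" by blast
    have "n = m"
      using dyadic_level_unique[of n "2 ^ n + k" m] assms l by auto
    then show "p = apex \<epsilon> n k" using l by simp
  qed (use assms in auto)
  moreover have "2 ^ n + 1 + k \<noteq> 1" "2 ^ n + 1 + k \<noteq> 2" using assms by auto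
  ultimately show ?thesis unfolding e_pt_def by simp
qed

lemma radius_level_eq:
  assumes "2 ^ Suc n < i" "i \<le> 2 ^ Suc (Suc n)"
  shows "radius_level i = n"
proof -
  have "2 + (\<Sum>j\<le>m. 2 ^ j) \<le> i \<and> i \<le> 1 + (\<Sum>j\<le>m + 1. 2 ^ j) \<longleftrightarrow> 2 ^ Suc m < i \<and> i \<le> 2 ^ Suc (Suc m)" for m
    using one_le_power[of "2::nat" m]
    by (auto simp: sum_powers_of_two lessThan_Suc_atMost[symmetric] simp del: sum.lessThan_Suc)
  note level = this
  show ?thesis
    unfolding radius_level_def level
    using assms dyadic_level_unique[of "Suc n" i "Suc _"] by (intro the_equality) blast+
qed

lemma rho_pos: "0 < rho \<epsilon> i"
  unfolding rho_def by (intro mult_pos_pos) (auto simp: add_pos_nonneg)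

lemma radius_apex_pos:
  assumes "k \<in> {1..2 ^ m}"
  shows "0 < radius \<epsilon> (2 ^ m + 1 + k)"
proof -
  define i where "i = 2 ^ m + 1 + k"
  have level: "radius_level i \<le> m"
  \<comment> \<open>The shift between the two level counts: the last apex of level \<open>m\<close>
    has index \<open>2 ^ Suc m + 1\<close> and radius level \<open>m\<close>; all others have index
    at most \<open>2 ^ Suc m\<close> and radius level \<open>m - 1\<close>. At \<open>m = 0\<close>
    the only apex is the last one.\<close>
  proof (cases "k = 2 ^ m")
    case True
    then have "radius_level i = m" by (intro radius_level_eq) (auto simp: i_def)
    then show ?thesis by simp
  next
    case False
    then have "m \<noteq> 0" using assms by (cases m) auto
    then obtain n where "m = Suc n" using not0_implies_Suc by blast
    moreover have "radius_level i = n"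
      using assms False \<open>m = Suc n\<close> by (intro radius_level_eq) (auto simp: i_def)
    ultimately show ?thesis by simp
  qed
  have "0 < infdist (e_pt \<epsilon> i) (\<Union>l\<in>{n - 2..<n}. A_curve \<epsilon> l)" if "n = radius_level i" "n \<noteq> 0" for n
  proof (rule infdist_pos_not_in_closed)
    show "closed (\<Union>l\<in>{n - 2..<n}. A_curve \<epsilon> l)" using closed_A_curve by (intro closed_UN) auto
    \<comment> \<open>The union must be nonempty, as \<open>infdist\<close> to the empty set is
      0.\<close>
    have "vertices \<epsilon> (n - 1) \<noteq> {}" by (auto simp: vertices_def ends_def)
    then have "A_curve \<epsilon> (n - 1) \<noteq> {}" using vertices_subset_A_curve by blast
    moreover have "n - 1 \<in> {n - 2..<n}" using that by auto
    ultimately show "(\<Union>l\<in>{n - 2..<n}. A_curve \<epsilon> l) \<noteq> {}" by blast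
    show "e_pt \<epsilon> i \<notin> (\<Union>l\<in>{n - 2..<n}. A_curve \<epsilon> l)"
      using e_pt_apex[OF assms] apex_notin_A_curve[OF _ assms] that level unfolding i_def by auto
  qed
  then show ?thesis
    using rho_pos unfolding radius_def i_def[symmetric] by (auto simp: Let_def)
qed

text \<open>Every vertex is one of the enumerated centres, so a positive radius already puts it into
  its own ball.\<close>

lemma vertex_in_balls:
  assumes "x \<in> vertices \<epsilon> n"
  shows "x \<in> (\<Union>i\<in>{1..}. ball (e_pt \<epsilon> i) (radius \<epsilon> i))"
proof -
  have "\<exists>i\<ge>1. x = e_pt \<epsilon> i \<and> 0 < radius \<epsilon> i"
    using vertices_cases[OF assms]
  proof (elim disjE exE conjE)
    show ?thesis if "x = vector [0, 0]"
      using that rho_pos by (intro exI[of _ 1]) (auto simp: e_pt_def radius_def)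
    show ?thesis if "x = vector [1, 0]"
      using that rho_pos by (intro exI[of _ 2]) (auto simp: e_pt_def radius_def)
    show ?thesis if "k \<in> {1..2 ^ m}" "x = apex \<epsilon> m k" for m k
      using that e_pt_apex radius_apex_pos by (intro exI[of _ "2 ^ m + 1 + k"]) auto
  qed
  then obtain i where "1 \<le> i" "x \<in> ball (e_pt \<epsilon> i) (radius \<epsilon> i)" by auto
  then show ?thesis by blast
qed

section \<open>The closure of the curves and the complement of the set\<close>

lemma closure_curves_subset:
  "closure (\<Union>n\<in>{1..}. A_curve \<epsilon> n) \<subseteq> (\<Union>n\<in>{1..m}. A_curve \<epsilon> n) \<union> (\<Union>i\<in>{1..2 ^ m}. solid_cap \<epsilon> m i)"
proof (rule closure_minimal)
  show "closed ((\<Union>n\<in>{1..m}. A_curve \<epsilon> n) \<union> (\<Union>i\<in>{1..2 ^ m}. solid_cap \<epsilon> m i))"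
    by (intro closed_Un closed_UN) (auto simp: closed_A_curve solid_cap_def closed_triangle)
  \<comment> \<open>From level \<open>m\<close> on the curves are trapped in the caps of level
    \<open>m\<close>, so only finitely many closed sets are needed to cover all curves.\<close>
  have "A_curve \<epsilon> n \<subseteq> (\<Union>i\<in>{1..2 ^ m}. solid_cap \<epsilon> m i)" if "m \<le> n" for n
    using solid_cap_subset_ancestor[OF that] A_seg_subset_solid_cap
    unfolding A_curve_def by blast
  note above = this
  have "A_curve \<epsilon> n \<subseteq> (\<Union>n\<in>{1..m}. A_curve \<epsilon> n) \<union> (\<Union>i\<in>{1..2 ^ m}. solid_cap \<epsilon> m i)"
    if "1 \<le> n" for n
  proof (cases "m \<le> n")
    case True
    then show ?thesis using above by blast
  next
    case False
    then have "n \<in> {1..m}" using \<open>1 \<le> n\<close> by simp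
    then show ?thesis by blast
  qed
  then show "(\<Union>n\<in>{1..}. A_curve \<epsilon> n) \<subseteq> (\<Union>n\<in>{1..m}. A_curve \<epsilon> n) \<union> (\<Union>i\<in>{1..2 ^ m}. solid_cap \<epsilon> m i)"
    by (intro UN_least) simp
qed

end

theorem lemma3p1:
  fixes \<epsilon> :: real
  assumes "0 < \<epsilon>" and "\<epsilon> < 1 / 100"
  shows "closed (calA_eps \<epsilon>)"
proof -
  let ?U = "\<Union>n\<in>{1..}. A_curve \<epsilon> n" and ?B = "\<Union>i\<in>{1..}. ball (e_pt \<epsilon> i) (radius \<epsilon> i)"
  have "\<exists>W. open W \<and> x \<in> W \<and> W \<subseteq> - calA_eps \<epsilon>" if x: "x \<in> - calA_eps \<epsilon>" for x
  proof -
    consider "x \<notin> closure ?U" | "x \<in> ?B" | "x \<in> ?U" "x \<notin> ?B"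
      using x by (auto simp: calA_eps_def A_eps_def)
    then show ?thesis
    proof cases
      case 1
      then show ?thesis by (intro exI[of _ "- closure ?U"]) (auto simp: calA_eps_def A_eps_def)
    next
      case 2
      then show ?thesis by (intro exI[of _ ?B]) (auto simp: calA_eps_def)
    next
      case 3
      then obtain n i where n: "1 \<le> n" "i \<in> {1..2 ^ n}" "x \<in> A_seg \<epsilon> n i" by (auto simp: A_curve_def)
      \<comment> \<open>Vertices lie in the removed balls, so \<open>x\<close> is not a vertex, and
        hence no cap of level \<open>n + 1\<close> contains it.\<close>
      have "x \<notin> ends \<epsilon> n i"
        using vertex_in_balls[OF assms, of x n] n(2) 3(2) unfolding vertices_def by blast
      define W where "W = - (\<Union>j\<in>{1..2 ^ Suc n}. solid_cap \<epsilon> (Suc n) j)"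
      have "open W" unfolding W_def
        by (intro open_Compl closed_UN) (auto simp: solid_cap_def closed_triangle)
      moreover have "x \<in> W"
        using A_seg_inter_next_caps[OF assms n(2) _ n(3)] \<open>x \<notin> ends \<epsilon> n i\<close> unfolding W_def by blast
      \<comment> \<open>With the caps of level \<open>n + 1\<close> in the role of \<open>Q\<close>,
        the closure adds nothing to the curves inside \<open>W\<close>. Since \<open>A_eps\<close>
        removes the curves themselves, \<open>W\<close> misses it.\<close>
      moreover have "P \<subseteq> U \<Longrightarrow> C \<subseteq> P \<union> Q \<Longrightarrow> - Q \<inter> C \<subseteq> U" for P Q C U :: "point set"
        by blast
      from this[OF _ closure_curves_subset[OF assms, of "Suc n"]] have "W \<inter> closure ?U \<subseteq> ?U"
        unfolding W_def by (simp add: UN_mono)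
      then have "W \<subseteq> - calA_eps \<epsilon>" by (auto simp: calA_eps_def A_eps_def)
      ultimately show ?thesis by blast
    qed
  qed
  then have "open (- calA_eps \<epsilon>)" by (subst open_subopen) blast
  then show ?thesis by (simp add: closed_def)
qed

end
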